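(* Let $t \in \Sigma^*$ be a finite trace. Then, for all LTL formulae $\varphi$ and $\varphi'$ with $\varphi \xrightarrow{t} \varphi'$: (1) $t \in [\![\varphi]\!]_3(\mathrm{T})$ if and only if $[\![\varphi']\!]_3(\mathrm{T}) = \Sigma^\infty$; (2) $t \in [\![\varphi]\!]_3(\mathrm{F})$ if and only if $[\![\varphi']\!]_3(\mathrm{F}) = \Sigma^\infty$.
   Context: Traces. Fix a set $A$ of atomic propositions and let $\Sigma = \mathcal{P}(A)$ be the set of states. $\Sigma^*$ is the set of finite traces (including the empty trace $\varepsilon$), $\Sigma^\omega$ the set of infinite traces, $\Sigma^\infty = \Sigma^* \cup \Sigma^\omega$. Concatenation is written $tu$, with $tu = t$ if $t$ is infinite. $t_0$ is the first state of a nonempty trace $t$; $t|_n$ is $t$ without its first $n$ states ($\varepsilon$ if $n$ exceeds the length of $t$). Definitive sets. For $X \subseteq \Sigma^\infty$, $\downarrow X = \{u \mid \exists t \in X.\ \exists v \in \Sigma^\infty.\ t = uv\}$; $\uparrow t = \{tu \mid u \in \Sigma^\infty\}$; $\mathrm{dp}(X) = \{t \in \Sigma^\infty\mid \uparrow t \subseteq \downarrow X\}$. $X$ is definitive iff $X = \mathrm{dp}(X)$. Definitive union: $X \sqcup Y = \mathrm{dp}(X \cup Y)$ and $\bigsqcup S = \mathrm{dp}(\bigcup S)$. Prepend: $\triangleright X = \{t \in \Sigma^\infty \mid t|_1 \in X\}$. LTL formulae: $\varphi,\psi ::= \top \mid a \mid \neg\varphi \mid \varphi\wedge\psi \mid \bigcirc\varphi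 \mid \varphi\,\mathcal{U}\,\psi$ with $a \in A$; $\bot$ abbreviates $\neg\top$ and $\varphi\vee\psi$ abbreviates $\neg(\neg\varphi\wedge\neg\psi)$. LTL$_3$ semantics $[\![\varphi]\!]_3$ assigns to each answer in $\{\mathrm{T},\mathrm{F}\}$ a definitive set, by recursion: $[\![\top]\!]_3(\mathrm{T}) = \Sigma^\infty$, $[\![\top]\!]_3(\mathrm{F}) = \emptyset$; $[\![a]\!]_3(\mathrm{T}) = \mathrm{dp}\{t\in\Sigma^\infty \mid t\ne\varepsilon \wedge a \in t_0\}$, $[\![a]\!]_3(\mathrm{F}) = \mathrm{dp}\{t\in\Sigma^\infty \mid t\neq\varepsilon \wedge a \notin t_0\}$; $[\![\neg\varphi]\!]_3(\mathrm{T}) = [\![\varphi]\!]_3(\mathrm{F})$, $[\![\neg\varphi]\!]_3(\mathrm{F}) = [\![\varphi]\!]_3(\mathrm{T})$; $[\![\varphi\wedge\psi]\!]_3(\mathrm{T}) = [\![\varphi]\!]_3(\mathrm{T})\cap[\![\psi]\!]_3(\mathrm{T})$, $[\![\varphi\wedge\psi]\!]_3(\mathrm{F}) = [\![\varphi]\!]_3(\mathrm{F})\sqcup[\![\psi]\!]_3(\mathrm{F})$; (consequently $[\![\varphi\vee\psi]\!]_3(\mathrm{T}) = [\![\varphi]\!]_3(\mathrm{T})\sqcup[\![\psi]\!]_3(\mathrm{T})$, $[\![\varphi\vee\psi]\!]_3(\mathrm{F}) = [\![\varphi]\!]_3(\mathrm{F})\cap[\![\psi]\!]_3(\mathrm{F})$);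 $[\![\bigcirc\varphi]\!]_3(b) = \triangleright([\![\varphi]\!]_3(b))$ for $b\in\{\mathrm{T},\mathrm{F}\}$; $[\![\varphi\,\mathcal{U}\,\psi]\!]_3(\mathrm{T}) = \bigsqcup_{k\in\mathbb{N}} f^k([\![\psi]\!]_3(\mathrm{T}))$ where $f(X) = \triangleright X \cap [\![\varphi]\!]_3(\mathrm{T})$; $[\![\varphi\,\mathcal{U}\,\psi]\!]_3(\mathrm{F}) = \bigcap_{k\in\mathbb{N}} g^k([\![\psi]\!]_3(\mathrm{F}))$ where $g(X) = \triangleright X \sqcup [\![\varphi]\!]_3(\mathrm{F})$. Here $f^k$ is the $k$-fold self-composition of $f$ ($f^0$ the identity). Formula progression. For $\sigma\in\Sigma$, the relation $\varphi \xrightarrow{\sigma} \varphi'$ (a total function of $(\varphi,\sigma)$) is given by the rules: $\top \xrightarrow{\sigma} \top$; $a \xrightarrow{\sigma} \top$ if $a \in \sigma$; $a \xrightarrow{\sigma} \bot$ if $a \notin\sigma$; $\bigcirc\varphi \xrightarrow{\sigma} \varphi$; if $\varphi \xrightarrow{\sigma}\varphi'$ then $\neg\varphi \xrightarrow{\sigma} \neg\varphi'$; if $\varphi \xrightarrow{\sigma}\varphi'$ and $\psi\xrightarrow{\sigma}\psi'$ then $\varphi\wedge\psi \xrightarrow{\sigma} \varphi'\wedge\psi'$ and $\varphi\,\mathcal{U}\,\psi \xrightarrow{\sigma} \psi' \vee (\varphi' \wedge (\varphi\,\mathcal{U}\,\psi))$. For a finite trace $t = \sigma_0\cdots\sigma_n$,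 $\varphi\xrightarrow{t}\psi$ means $\varphi \xrightarrow{\sigma_0}\cdots\xrightarrow{\sigma_n}\psi$ (successive progression through intermediate formulae); $\varphi \xrightarrow{\varepsilon}\psi$ means $\psi = \varphi$. *)

theory Defs
  imports Main "HOL-Library.Stream"
begin

text \<open>
  The set of atomic propositions is the universe of the type variable \<open>'a\<close>. A state is a set of
  propositions, so \<open>'a trace\<close> is the set of all finite and infinite traces and its \<open>UNIV\<close>
  plays the role of \<open>\<Sigma>\<^sup>\<infinity>\<close>.
\<close>

type_synonym 'a state = "'a set"

datatype 'a trace = Fin "'a state list" | Inf "'a state stream"

fun tconc :: "'a trace \<Rightarrow> 'a trace \<Rightarrow> 'a trace" (infixr "\<cdot>\<^sub>t" 65) where
  "Fin xs \<cdot>\<^sub>t Fin ys = Fin (xs @ ys)"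
| "Fin xs \<cdot>\<^sub>t Inf s = Inf (xs @- s)"
| "Inf s \<cdot>\<^sub>t u = Inf s"

text \<open>The first state; meaningful for nonempty traces only.\<close>

fun tfirst :: "'a trace \<Rightarrow> 'a state" where
  "tfirst (Fin xs) = hd xs"
| "tfirst (Inf s) = shd s"

fun tdrop :: "nat \<Rightarrow> 'a trace \<Rightarrow> 'a trace" where
  "tdrop n (Fin xs) = Fin (drop n xs)"
| "tdrop n (Inf s) = Inf (sdrop n s)"

definition down :: "'a trace set \<Rightarrow> 'a trace set" where
  "down X = {u. \<exists>t\<in>X. \<exists>v. t = u \<cdot>\<^sub>t v}"

definition up :: "'a trace \<Rightarrow> 'a trace set" where
  "up t = {t \<cdot>\<^sub>t u |u. True}"

definition dp :: "'a trace set \<Rightarrow> 'a trace set" where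
  "dp X = {t. up t \<subseteq> down X}"

definition dunion :: "'a trace set \<Rightarrow> 'a trace set \<Rightarrow> 'a trace set" (infixl "\<squnion>\<^sub>d" 65) where
  "X \<squnion>\<^sub>d Y = dp (X \<union> Y)"

definition dUnion :: "'a trace set set \<Rightarrow> 'a trace set" where
  "dUnion S = dp (\<Union>S)"

definition prepend :: "'a trace set \<Rightarrow> 'a trace set" where
  "prepend X = {t. tdrop 1 t \<in> X}"

datatype 'a ltl =
    LTop
  | LAtom 'a
  | LNot "'a ltl"
  | LAnd "'a ltl" "'a ltl"
  | LNext "'a ltl"
  | LUntil "'a ltl" "'a ltl"

abbreviation LBot :: "'a ltl" where
  "LBot \<equiv> LNot LTop"

abbreviation LOr :: "'a ltl \<Rightarrow> 'a ltl \<Rightarrow> 'a ltl" where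
  "LOr \<phi> \<psi> \<equiv> LNot (LAnd (LNot \<phi>) (LNot \<psi>))"

datatype answer = AnsT | AnsF

fun sem3 :: "'a ltl \<Rightarrow> answer \<Rightarrow> 'a trace set" where
  "sem3 LTop AnsT = UNIV"
| "sem3 LTop AnsF = {}"
| "sem3 (LAtom a) AnsT = dp {t. t \<noteq> Fin [] \<and> a \<in> tfirst t}"
| "sem3 (LAtom a) AnsF = dp {t. t \<noteq> Fin [] \<and> a \<notin> tfirst t}"
| "sem3 (LNot \<phi>) AnsT = sem3 \<phi> AnsF"
| "sem3 (LNot \<phi>) AnsF = sem3 \<phi> AnsT"
| "sem3 (LAnd \<phi> \<psi>) AnsT = sem3 \<phi> AnsT \<inter> sem3 \<psi> AnsT"
| "sem3 (LAnd \<phi> \<psi>) AnsF = sem3 \<phi> AnsF \<squnion>\<^sub>d sem3 \<psi> AnsF"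
| "sem3 (LNext \<phi>) b = prepend (sem3 \<phi> b)"
| "sem3 (LUntil \<phi> \<psi>) AnsT =
     dUnion (range (\<lambda>k. ((\<lambda>X. prepend X \<inter> sem3 \<phi> AnsT) ^^ k) (sem3 \<psi> AnsT)))"
| "sem3 (LUntil \<phi> \<psi>) AnsF =
     (\<Inter>k. ((\<lambda>X. prepend X \<squnion>\<^sub>d sem3 \<phi> AnsF) ^^ k) (sem3 \<psi> AnsF))"

inductive prog :: "'a ltl \<Rightarrow> 'a state \<Rightarrow> 'a ltl \<Rightarrow> bool" where
  prog_top: "prog LTop \<sigma> LTop"
| prog_atom_in: "a \<in> \<sigma> \<Longrightarrow> prog (LAtom a) \<sigma> LTop"
| prog_atom_notin: "a \<notin> \<sigma> \<Longrightarrow> prog (LAtom a) \<sigma> LBot"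
| prog_next: "prog (LNext \<phi>) \<sigma> \<phi>"
| prog_not: "prog \<phi> \<sigma> \<phi>' \<Longrightarrow> prog (LNot \<phi>) \<sigma> (LNot \<phi>')"
| prog_and: "\<lbrakk>prog \<phi> \<sigma> \<phi>'; prog \<psi> \<sigma> \<psi>'\<rbrakk> \<Longrightarrow> prog (LAnd \<phi> \<psi>) \<sigma> (LAnd \<phi>' \<psi>')"
| prog_until: "\<lbrakk>prog \<phi> \<sigma> \<phi>'; prog \<psi> \<sigma> \<psi>'\<rbrakk>
    \<Longrightarrow> prog (LUntil \<phi> \<psi>) \<sigma> (LOr \<psi>' (LAnd \<phi>' (LUntil \<phi> \<psi>)))"

inductive_simps prog_simps:
  "prog LTop \<sigma> \<chi>"
  "prog (LAtom a) \<sigma> \<chi>"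
  "prog (LNot \<phi>) \<sigma> \<chi>"
  "prog (LAnd \<phi> \<psi>) \<sigma> \<chi>"
  "prog (LNext \<phi>) \<sigma> \<chi>"
  "prog (LUntil \<phi> \<psi>) \<sigma> \<chi>"

lemma prog_total_function: "\<exists>!\<phi>'. prog \<phi> \<sigma> \<phi>'"
proof (induction \<phi>)
  case (LAtom a)
  show ?case by (cases "a \<in> \<sigma>") (simp_all add: prog_simps)
next
  case (LNot \<phi>)
  then show ?case unfolding prog_simps by metis
next
  case (LAnd \<phi> \<psi>)
  then show ?case unfolding prog_simps by metis
next
  case (LUntil \<phi> \<psi>)
  then show ?case unfolding prog_simps by metis
qed (simp_all add: prog_simps)

fun prog_trace :: "'a ltl \<Rightarrow> 'a state list \<Rightarrow> 'a ltl \<Rightarrow> bool" where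
  "prog_trace \<phi> [] \<psi> \<longleftrightarrow> \<psi> = \<phi>"
| "prog_trace \<phi> (\<sigma> # t) \<psi> \<longleftrightarrow> (\<exists>\<chi>. prog \<phi> \<sigma> \<chi> \<and> prog_trace \<chi> t \<psi>)"

end

theory Submission
  imports Defs
begin

text \<open>
  A definitive set is determined by its infinite traces: it consists of exactly those traces all of
  whose infinite extensions lie in a fixed language \<open>L\<close>. Under this correspondence the operations of
  the three-valued semantics become the Boolean and shift operations on languages, so that the two
  answers of a formula are given by its ordinary LTL language and the complement of that language.
  Progression along \<open>\<sigma>\<close> takes the quotient of this language by \<open>\<sigma>\<close>, and the theorem says that
  all infinite extensions of \<open>t\<close> lie in \<open>L\<close> iff the quotient of \<open>L\<close> by \<open>t\<close> is everything.
\<close>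

fun extend :: "'a trace \<Rightarrow> 'a state stream \<Rightarrow> 'a state stream" where
  "extend (Fin xs) w = xs @- w"
| "extend (Inf s) w = s"

definition definitive :: "'a state stream set \<Rightarrow> 'a trace set" where
  "definitive L = {t. \<forall>w. extend t w \<in> L}"

lemma Inf_in_definitive [simp]: "Inf s \<in> definitive L \<longleftrightarrow> s \<in> L"
  by (simp add: definitive_def)

lemma Fin_in_definitive: "Fin xs \<in> definitive L \<longleftrightarrow> (\<forall>w. xs @- w \<in> L)"
  by (simp add: definitive_def)

lemma definitive_UNIV [simp]: "definitive UNIV = UNIV"
  by (simp add: definitive_def)

lemma definitive_empty [simp]: "definitive {} = {}"
  by (simp add: definitive_def)

lemma definitive_eq_UNIV_iff: "definitive L = UNIV \<longleftrightarrow> L = UNIV"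
  by (metis Inf_in_definitive UNIV_I definitive_UNIV UNIV_eq_I)

lemma definitive_Int: "definitive L \<inter> definitive M = definitive (L \<inter> M)"
  by (auto simp: definitive_def)

lemma definitive_INT: "(\<Inter>i\<in>I. definitive (L i)) = definitive (\<Inter>i\<in>I. L i)"
  by (auto simp: definitive_def)

lemma tconc_Inf: "t \<cdot>\<^sub>t Inf w = Inf (extend t w)"
  by (cases t) auto

lemma tconc_Fin_in_down:
  assumes "t \<cdot>\<^sub>t Inf (ys @- w) \<in> X"
  shows "t \<cdot>\<^sub>t Fin ys \<in> down X"
proof -
  have "t \<cdot>\<^sub>t Inf (ys @- w) = (t \<cdot>\<^sub>t Fin ys) \<cdot>\<^sub>t Inf w"
    by (cases t) auto
  with assms show ?thesis
    unfolding down_def by blast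
qed

lemma Inf_in_down_iff: "Inf s \<in> down X \<longleftrightarrow> Inf s \<in> X"
  by (simp add: down_def)

text \<open>An infinite trace has no extension but itself, so it is in \<open>down X\<close> only if
  it is in \<open>X\<close>. Finite extensions of \<open>t\<close> impose nothing further, each
  being a prefix of an infinite extension of \<open>t\<close>.\<close>

lemma dp_eq_definitive: "dp X = definitive {s. Inf s \<in> X}"
proof (intro set_eqI iffI)
  fix t assume "t \<in> dp X"
  then have "t \<cdot>\<^sub>t Inf w \<in> down X" for w
    by (auto simp: dp_def up_def)
  then show "t \<in> definitive {s. Inf s \<in> X}"
    by (simp add: definitive_def tconc_Inf Inf_in_down_iff)
next
  fix t assume "t \<in> definitive {s. Inf s \<in> X}"
  then have inf: "t \<cdot>\<^sub>t Inf w \<in> X" for w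
    by (simp add: definitive_def tconc_Inf)
  have "t \<cdot>\<^sub>t u \<in> down X" for u
  proof (cases u)
    case (Fin ys)
    then show ?thesis
      using tconc_Fin_in_down inf by blast
  next
    case (Inf s)
    then show ?thesis
      using inf[of s] by (simp add: tconc_Inf Inf_in_down_iff)
  qed
  then show "t \<in> dp X"
    by (auto simp: dp_def up_def)
qed

lemma dunion_definitive: "definitive L \<squnion>\<^sub>d definitive M = definitive (L \<union> M)"
  by (simp add: dunion_def dp_eq_definitive Un_def)

lemma dUnion_definitive:
  "dUnion (range (\<lambda>i. definitive (L i))) = definitive (\<Union>i. L i)"
  by (simp add: dUnion_def dp_eq_definitive UNION_eq)

lemma prepend_definitive: "prepend (definitive L) = definitive (stl -` L)"
proof (rule set_eqI)
  fix t :: "'a trace"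
  show "t \<in> prepend (definitive L) \<longleftrightarrow> t \<in> definitive (stl -` L)"
  proof (cases t)
    case (Fin xs)
    show ?thesis
    proof (cases xs)
      case Nil
      \<comment> \<open>\<open>tdrop\<close> leaves the empty trace unchanged; shifting
        \<open>L\<close> makes no difference there because \<open>stl\<close> is surjective.\<close>
      have "(\<forall>w. w \<in> L) \<longleftrightarrow> (\<forall>w. stl w \<in> L)"
        by (metis stream.sel(2))
      then show ?thesis
        using Fin Nil by (simp add: prepend_def Fin_in_definitive)
    next
      case (Cons x xs')
      then show ?thesis
        using Fin by (simp add: prepend_def Fin_in_definitive)
    qed
  next
    case (Inf s)
    then show ?thesis
      by (simp add: prepend_def)
  qed
qed

text \<open>Standard LTL semantics, with until as a union of iterates rather than a condition on
  positions, to match \<open>sem3\<close> for each \<open>k\<close>.\<close>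

primrec lang :: "'a ltl \<Rightarrow> 'a state stream set" where
  "lang LTop = UNIV"
| "lang (LAtom a) = {s. a \<in> shd s}"
| "lang (LNot \<phi>) = - lang \<phi>"
| "lang (LAnd \<phi> \<psi>) = lang \<phi> \<inter> lang \<psi>"
| "lang (LNext \<phi>) = stl -` lang \<phi>"
| "lang (LUntil \<phi> \<psi>) = (\<Union>k. ((\<lambda>L. stl -` L \<inter> lang \<phi>) ^^ k) (lang \<psi>))"

lemma funpow_prepend_Int:
  "((\<lambda>X. prepend X \<inter> definitive L) ^^ k) (definitive M) =
     definitive (((\<lambda>X. stl -` X \<inter> L) ^^ k) M)"
  by (induction k) (simp_all add: prepend_definitive definitive_Int)

text \<open>De Morgan, and preimages commute with complement.\<close>

lemma funpow_prepend_dunion: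
  "((\<lambda>X. prepend X \<squnion>\<^sub>d definitive (- L)) ^^ k) (definitive (- M)) =
     definitive (- ((\<lambda>X. stl -` X \<inter> L) ^^ k) M)"
  by (induction k) (simp_all add: prepend_definitive dunion_definitive vimage_Compl)

text \<open>Negation swaps the answers, so the induction must carry both.\<close>

lemma sem3_eq_definitive:
  "sem3 \<phi> AnsT = definitive (lang \<phi>) \<and> sem3 \<phi> AnsF = definitive (- lang \<phi>)"
proof (induction \<phi>)
  case (LUntil \<phi> \<psi>)
  then show ?case
    by (simp add: funpow_prepend_Int funpow_prepend_dunion dUnion_definitive definitive_INT)
qed (simp_all add: dp_eq_definitive definitive_Int dunion_definitive prepend_definitive
      vimage_Compl Collect_neg_eq)

text \<open>The expansion law: split off \<open>k = 0\<close>; preimage and intersection distribute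
  over the union of the later iterates.\<close>

lemma lang_until_unfold:
  "lang (LUntil \<phi> \<psi>) = lang \<psi> \<union> (stl -` lang (LUntil \<phi> \<psi>) \<inter> lang \<phi>)"
proof -
  let ?f = "\<lambda>L. stl -` L \<inter> lang \<phi>"
  have "(\<Union>k. (?f ^^ k) (lang \<psi>)) = (?f ^^ 0) (lang \<psi>) \<union> (\<Union>k. (?f ^^ Suc k) (lang \<psi>))"
    unfolding set_eq_iff UN_iff Un_iff by (metis UNIV_I not0_implies_Suc)
  then show ?thesis
    unfolding lang.simps(6) vimage_UN funpow.simps o_apply id_apply UN_simps(4) .
qed

lemma prog_lang: "prog \<phi> \<sigma> \<phi>' \<Longrightarrow> s \<in> lang \<phi>' \<longleftrightarrow> \<sigma> ## s \<in> lang \<phi>"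
proof (induction rule: prog.induct)
  case (prog_until \<phi> \<sigma> \<phi>' \<psi> \<psi>')
  then show ?case
    \<comment> \<open>Only the until of the original formula is expanded; deleting
      \<open>lang.simps(6)\<close> keeps the remaining ones folded, so both sides match.\<close>
    by (subst lang_until_unfold) (simp del: lang.simps(6), blast)
qed simp_all

lemma prog_trace_lang: "prog_trace \<phi> t \<phi>' \<Longrightarrow> s \<in> lang \<phi>' \<longleftrightarrow> t @- s \<in> lang \<phi>"
  by (induction t arbitrary: \<phi>) (simp, metis prog_lang prog_trace.simps(2) shift.simps(2))

theorem theorem11:
  fixes t :: "'a state list" and \<phi> \<phi>' :: "'a ltl"
  assumes "prog_trace \<phi> t \<phi>'"
  shows "(Fin t \<in> sem3 \<phi> AnsT \<longleftrightarrow> sem3 \<phi>' AnsT = UNIV) \<and>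
         (Fin t \<in> sem3 \<phi> AnsF \<longleftrightarrow> sem3 \<phi>' AnsF = UNIV)"
  using prog_trace_lang[OF assms]
  by (auto simp: sem3_eq_definitive definitive_eq_UNIV_iff Fin_in_definitive)

end
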